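(* Let $S=\mathscr{M}[G;I,\Lambda;P]$ be a completely simple semigroup. Each cross-connection $\Gamma:\mathcal{R}(S)\to N^\ast\mathcal{L}(S)$ determines a $\Lambda\times I$ matrix $A$ with entries from the group $G$ such that $\Gamma(\bar i)=A_iG$ for every $i\in I$, where $A_i\in G^\Lambda$ is the $i$-th column of $A$ and $A_iG$ is its left coset modulo $G$ in $G^\Lambda$.
   Context: $G$ is a group, $I,\Lambda$ are nonempty sets, $P=(p_{\lambda i})$ is a $\Lambda\times I$ matrix over $G$, and $S=\mathscr{M}[G;I,\Lambda;P]=G\times I\times\Lambda$ with product $(a,i,\lambda)(b,j,\mu)=(ap_{\lambda j}b,i,\mu)$. Composition is written left to right. $\mathcal{L}(S)$: objects are the principal left ideals $\bar\lambda=G\times I\times\{\lambda\}$, $\lambda\in\Lambda$; morphisms $\bar\lambda_1\to\bar\lambda_2$ are the maps $\rho(g):(h,i,\lambda_1)\mapsto(hg,i,\lambda_2)$, $g\in G$. $\mathcal{R}(S)$: objects are the principal right ideals $\bar i=G\times\{i\}\times\Lambda$, $i\in I$; morphisms $\bar i_1\to\bar i_2$ are the maps $\kappa(g):(h,i_1,\lambda)\mapsto(gh,i_2,\lambda)$, $g\in G$. In both categories all inclusions are identities. Normal cones in $\mathcal{L}(S)$ with vertex $\bar\lambda$ are families of morphisms $\gamma(\bar\mu):\bar\mu\to\bar\lambda$ ($\mu\in\Lambda$), identified with pairs $(\bar\gamma,\lambda)\in G^\Lambda\times\Lambda$ via $\gamma(\bar\mu)=\rho(\bar\gamma(\mu))$;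 their semigroup $T\mathcal{L}(S)$ has product $(\bar\gamma_1,\lambda_k)\ast(\bar\gamma_2,\lambda_l)=(\bar\gamma_1\cdot\bar g_k,\lambda_l)$, $g_k=\bar\gamma_2(\lambda_k)$, $\bar g_k=(g_k,g_k,\dots)$. Normal dual: for $\gamma=(\bar\gamma,\lambda_k)$, $H(\gamma;-):\mathcal{L}(S)\to\mathbf{Set}$ is the functor $H(\gamma;\bar\lambda)=\{\gamma\ast f: f:\bar\lambda_k\to\bar\lambda\}=\{(\bar\gamma g,\lambda):g\in G\}$, $H(\gamma;f'):\gamma\ast f\mapsto\gamma\ast(ff')$ (here $\gamma\ast f$ is the cone with components $\gamma(\bar\mu)f$). $N^\ast\mathcal{L}(S)$ is the full subcategory of the category of functors $\mathcal{L}(S)\to\mathbf{Set}$ on the objects $H(\epsilon;-)$, $\epsilon$ an idempotent of $T\mathcal{L}(S)$. The object $H(\gamma;-)$ depends only on, and is identified with, the left coset $\bar\gamma G$ of $G$ (constant functions) in $G^\Lambda$. $MH(\gamma;-)$ is the set of objects $\bar\mu$ at which $\gamma(\bar\mu)$ is an isomorphism (here all objects). A local isomorphism $F:\mathcal{C}\to\mathcal{D}$ of normal categories is an inclusion-preserving, fully faithful functor such that for every object $c$ the restriction of $F$ to the full subcategory $\langle c\rangle$ of subobjects of $c$ is an isomorphism onto $\langle F(c)\rangle$. A cross-connection $\Gamma:\mathcal{D}\to N^\ast\mathcal{C}$ is a local isomorphism such that every object $c$ of $\mathcal{C}$ lies in $M\Gamma(d)$ for some object $d$ of $\mathcal{D}$.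 *)

theory Defs
  imports "HOL-Algebra.Product_Groups"
begin

section \<open>Categories with subobjects\<close>

text \<open>Composition is written in diagrammatic order: \<open>Comp C f g\<close> is first \<open>f\<close>, then \<open>g\<close>.
  \<open>Incl\<close> is the set of distinguished inclusion morphisms.\<close>

record ('o, 'a) cat =
  Obj :: "'o set"
  Arr :: "'a set"
  Dom :: "'a \<Rightarrow> 'o"
  Cod :: "'a \<Rightarrow> 'o"
  Ident :: "'o \<Rightarrow> 'a"
  Comp :: "'a \<Rightarrow> 'a \<Rightarrow> 'a"
  Incl :: "'a set"

definition hom_set :: "('o, 'a) cat \<Rightarrow> 'o \<Rightarrow> 'o \<Rightarrow> 'a set" where
  "hom_set C c d = {f \<in> Arr C. Dom C f = c \<and> Cod C f = d}"

definition isomorphism :: "('o, 'a) cat \<Rightarrow> 'a \<Rightarrow> bool" where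
  "isomorphism C f \<longleftrightarrow> f \<in> Arr C \<and>
     (\<exists>g \<in> hom_set C (Cod C f) (Dom C f).
        Comp C f g = Ident C (Dom C f) \<and> Comp C g f = Ident C (Cod C f))"

definition full_subcat :: "('o, 'a) cat \<Rightarrow> 'o set \<Rightarrow> ('o, 'a) cat" where
  "full_subcat C X = C\<lparr>Obj := X,
     Arr := {f \<in> Arr C. Dom C f \<in> X \<and> Cod C f \<in> X},
     Incl := {f \<in> Incl C. Dom C f \<in> X \<and> Cod C f \<in> X}\<rparr>"

definition subobjects :: "('o, 'a) cat \<Rightarrow> 'o \<Rightarrow> 'o set" where
  "subobjects C c = {c' \<in> Obj C. \<exists>j \<in> Incl C. j \<in> hom_set C c' c}"

definition ideal_cat :: "('o, 'a) cat \<Rightarrow> 'o \<Rightarrow> ('o, 'a) cat" where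
  "ideal_cat C c = full_subcat C (subobjects C c)"

record ('o, 'a, 'p, 'b) func =
  on_obj :: "'o \<Rightarrow> 'p"
  on_arr :: "'a \<Rightarrow> 'b"

definition is_functor :: "('o, 'a, 'p, 'b) func \<Rightarrow> ('o, 'a) cat \<Rightarrow> ('p, 'b) cat \<Rightarrow> bool" where
  "is_functor F C D \<longleftrightarrow>
     (\<forall>c \<in> Obj C. on_obj F c \<in> Obj D) \<and>
     (\<forall>f \<in> Arr C. on_arr F f \<in> hom_set D (on_obj F (Dom C f)) (on_obj F (Cod C f))) \<and>
     (\<forall>c \<in> Obj C. on_arr F (Ident C c) = Ident D (on_obj F c)) \<and>
     (\<forall>f \<in> Arr C. \<forall>g \<in> Arr C. Cod C f = Dom C g \<longrightarrow>
        on_arr F (Comp C f g) = Comp D (on_arr F f) (on_arr F g))"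

definition fully_faithful :: "('o, 'a, 'p, 'b) func \<Rightarrow> ('o, 'a) cat \<Rightarrow> ('p, 'b) cat \<Rightarrow> bool" where
  "fully_faithful F C D \<longleftrightarrow> (\<forall>c \<in> Obj C. \<forall>c' \<in> Obj C.
     bij_betw (on_arr F) (hom_set C c c') (hom_set D (on_obj F c) (on_obj F c')))"

definition inclusion_preserving ::
    "('o, 'a, 'p, 'b) func \<Rightarrow> ('o, 'a) cat \<Rightarrow> ('p, 'b) cat \<Rightarrow> bool" where
  "inclusion_preserving F C D \<longleftrightarrow> (\<forall>j \<in> Incl C. on_arr F j \<in> Incl D)"

definition cat_isomorphism ::
    "('o, 'a, 'p, 'b) func \<Rightarrow> ('o, 'a) cat \<Rightarrow> ('p, 'b) cat \<Rightarrow> bool" where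
  "cat_isomorphism F C D \<longleftrightarrow> is_functor F C D \<and>
     bij_betw (on_obj F) (Obj C) (Obj D) \<and> bij_betw (on_arr F) (Arr C) (Arr D)"

definition local_isomorphism ::
    "('o, 'a, 'p, 'b) func \<Rightarrow> ('o, 'a) cat \<Rightarrow> ('p, 'b) cat \<Rightarrow> bool" where
  "local_isomorphism F C D \<longleftrightarrow> is_functor F C D \<and> inclusion_preserving F C D \<and>
     fully_faithful F C D \<and>
     (\<forall>c \<in> Obj C. cat_isomorphism F (ideal_cat C c) (ideal_cat D (on_obj F c)))"

section \<open>Sets and set-valued functors\<close>

text \<open>A map between sets is a triple of its domain, its graph as an extensional function,
  and its codomain.\<close>

type_synonym 'x map_arr = "'x set \<times> ('x \<Rightarrow> 'x) \<times> 'x set"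

definition map_dom :: "'x map_arr \<Rightarrow> 'x set" where "map_dom f = fst f"
definition map_fun :: "'x map_arr \<Rightarrow> 'x \<Rightarrow> 'x" where "map_fun f = fst (snd f)"
definition map_cod :: "'x map_arr \<Rightarrow> 'x set" where "map_cod f = snd (snd f)"

definition set_cat :: "('x set, 'x map_arr) cat" where
  "set_cat = \<lparr>Obj = UNIV,
     Arr = {f. map_fun f \<in> map_dom f \<rightarrow>\<^sub>E map_cod f},
     Dom = map_dom, Cod = map_cod,
     Ident = (\<lambda>X. (X, \<lambda>x\<in>X. x, X)),
     Comp = (\<lambda>f g. (map_dom f, compose (map_dom f) (map_fun g) (map_fun f), map_cod g)),
     Incl = {(X, \<lambda>x\<in>X. x, Y) | X Y. X \<subseteq> Y}\<rparr>"

type_synonym ('o, 'a, 'x) set_func = "('o, 'a, 'x set, 'x map_arr) func"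

text \<open>A natural transformation is a triple of its source functor, its family of components,
  and its target functor.  An inclusion of functors is one all of whose components are set
  inclusions.\<close>

type_synonym ('o, 'a, 'x) nat_arr =
  "('o, 'a, 'x) set_func \<times> ('o \<Rightarrow> 'x map_arr) \<times> ('o, 'a, 'x) set_func"

definition natural_transformation ::
    "('o, 'a) cat \<Rightarrow> ('o, 'a, 'x) set_func \<Rightarrow> ('o, 'a, 'x) set_func \<Rightarrow> ('o \<Rightarrow> 'x map_arr) \<Rightarrow> bool" where
  "natural_transformation C F F' \<eta> \<longleftrightarrow> \<eta> \<in> extensional (Obj C) \<and>
     (\<forall>c \<in> Obj C. \<eta> c \<in> hom_set set_cat (on_obj F c) (on_obj F' c)) \<and>
     (\<forall>f \<in> Arr C. Comp set_cat (on_arr F f) (\<eta> (Cod C f)) = Comp set_cat (\<eta> (Dom C f)) (on_arr F' f))"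

definition set_functor_cat ::
    "('o, 'a) cat \<Rightarrow> (('o, 'a, 'x) set_func, ('o, 'a, 'x) nat_arr) cat" where
  "set_functor_cat C =
    (let FF = {F. is_functor F C set_cat \<and> on_obj F \<in> extensional (Obj C) \<and>
                  on_arr F \<in> extensional (Arr C)};
         NT = {(F, \<eta>, F') | F \<eta> F'. F \<in> FF \<and> F' \<in> FF \<and> natural_transformation C F F' \<eta>}
     in \<lparr>Obj = FF, Arr = NT,
         Dom = (\<lambda>(F, \<eta>, F'). F), Cod = (\<lambda>(F, \<eta>, F'). F'),
         Ident = (\<lambda>F. (F, \<lambda>c\<in>Obj C. Ident set_cat (on_obj F c), F)),
         Comp = (\<lambda>(F, \<eta>, F') (E, \<theta>, E'). (F, \<lambda>c\<in>Obj C. Comp set_cat (\<eta> c) (\<theta> c), E')),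
         Incl = {(F, \<eta>, F') \<in> NT. \<forall>c \<in> Obj C. \<eta> c \<in> Incl set_cat}\<rparr>)"

section \<open>Normal cones, the normal dual and cross-connections\<close>

text \<open>A cone is a pair of its family of components and its vertex.\<close>

type_synonym ('o, 'a) cone = "('o \<Rightarrow> 'a) \<times> 'o"

definition normal_cones :: "('o, 'a) cat \<Rightarrow> ('o, 'a) cone set" where
  "normal_cones C = {(\<gamma>, v). v \<in> Obj C \<and> \<gamma> \<in> extensional (Obj C) \<and>
     (\<forall>c \<in> Obj C. \<gamma> c \<in> hom_set C c v) \<and>
     (\<forall>j \<in> Incl C. Comp C j (\<gamma> (Cod C j)) = \<gamma> (Dom C j)) \<and>
     (\<exists>c \<in> Obj C. isomorphism C (\<gamma> c))}"

definition cone_act :: "('o, 'a) cat \<Rightarrow> ('o, 'a) cone \<Rightarrow> 'a \<Rightarrow> ('o, 'a) cone" where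
  "cone_act C \<gamma> f = (\<lambda>c\<in>Obj C. Comp C (fst \<gamma> c) f, Cod C f)"

text \<open>In general the product of cones \<open>\<gamma>\<close>, \<open>\<delta>\<close> and the functor \<open>H\<close> use the epimorphic component
  of the morphism acting on a cone.  The categories considered here have only isomorphisms and
  only identity inclusions, so that every morphism is its own epimorphic component.\<close>

definition cone_mult :: "('o, 'a) cat \<Rightarrow> ('o, 'a) cone \<Rightarrow> ('o, 'a) cone \<Rightarrow> ('o, 'a) cone" where
  "cone_mult C \<gamma> \<delta> = cone_act C \<gamma> (fst \<delta> (snd \<gamma>))"

definition idempotent_cones :: "('o, 'a) cat \<Rightarrow> ('o, 'a) cone set" where
  "idempotent_cones C = {\<epsilon> \<in> normal_cones C. cone_mult C \<epsilon> \<epsilon> = \<epsilon>}"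

definition H_obj :: "('o, 'a) cat \<Rightarrow> ('o, 'a) cone \<Rightarrow> 'o \<Rightarrow> ('o, 'a) cone set" where
  "H_obj C \<gamma> c = {cone_act C \<gamma> f | f. f \<in> hom_set C (snd \<gamma>) c}"

text \<open>The map \<open>H(\<gamma>; f')\<close> takes \<open>\<gamma> * f\<close> to \<open>\<gamma> * (f f') = (\<gamma> * f) * f'\<close>.\<close>

definition H_functor ::
    "('o, 'a) cat \<Rightarrow> ('o, 'a) cone \<Rightarrow> ('o, 'a, ('o, 'a) cone) set_func" where
  "H_functor C \<gamma> = \<lparr>
     on_obj = (\<lambda>c\<in>Obj C. H_obj C \<gamma> c),
     on_arr = (\<lambda>f'\<in>Arr C. (H_obj C \<gamma> (Dom C f'),
                \<lambda>\<delta>\<in>H_obj C \<gamma> (Dom C f'). cone_act C \<delta> f',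
                H_obj C \<gamma> (Cod C f')))\<rparr>"

definition normal_dual :: "('o, 'a) cat \<Rightarrow>
    (('o, 'a, ('o, 'a) cone) set_func, ('o, 'a, ('o, 'a) cone) nat_arr) cat" where
  "normal_dual C = full_subcat (set_functor_cat C) (H_functor C ` idempotent_cones C)"

definition M_set :: "('o, 'a) cat \<Rightarrow> ('o, 'a, ('o, 'a) cone) set_func \<Rightarrow> 'o set" where
  "M_set C F = {c \<in> Obj C. \<exists>\<gamma> \<in> normal_cones C. F = H_functor C \<gamma> \<and> isomorphism C (fst \<gamma> c)}"

definition cross_connection ::
    "('p, 'b, ('o, 'a, ('o, 'a) cone) set_func, ('o, 'a, ('o, 'a) cone) nat_arr) func \<Rightarrow>
     ('p, 'b) cat \<Rightarrow> ('o, 'a) cat \<Rightarrow> bool" where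
  "cross_connection \<Gamma> D C \<longleftrightarrow> local_isomorphism \<Gamma> D (normal_dual C) \<and>
     (\<forall>c \<in> Obj C. \<exists>d \<in> Obj D. c \<in> M_set C (on_obj \<Gamma> d))"

section \<open>Rees matrix semigroups and their categories of principal ideals\<close>

record 's semigroup_struct =
  scarrier :: "'s set"
  smult :: "'s \<Rightarrow> 's \<Rightarrow> 's"

definition principal_left_ideals :: "'s semigroup_struct \<Rightarrow> 's set set" where
  "principal_left_ideals S = {insert x {smult S s x | s. s \<in> scarrier S} | x. x \<in> scarrier S}"

definition principal_right_ideals :: "'s semigroup_struct \<Rightarrow> 's set set" where
  "principal_right_ideals S = {insert x {smult S x s | s. s \<in> scarrier S} | x. x \<in> scarrier S}"

definition rees :: "('g, 'm) monoid_scheme \<Rightarrow> 'i set \<Rightarrow> 'l set \<Rightarrow> ('l \<Rightarrow> 'i \<Rightarrow> 'g) \<Rightarrow>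
    ('g \<times> 'i \<times> 'l) semigroup_struct" where
  "rees G I \<Lambda> P = \<lparr>scarrier = carrier G \<times> I \<times> \<Lambda>,
     smult = (\<lambda>(a, i, l) (b, j, m). (a \<otimes>\<^bsub>G\<^esub> P l j \<otimes>\<^bsub>G\<^esub> b, i, m))\<rparr>"

definition lbar :: "('g, 'm) monoid_scheme \<Rightarrow> 'i set \<Rightarrow> 'l \<Rightarrow> ('g \<times> 'i \<times> 'l) set" where
  "lbar G I l = carrier G \<times> I \<times> {l}"

definition rbar :: "('g, 'm) monoid_scheme \<Rightarrow> 'l set \<Rightarrow> 'i \<Rightarrow> ('g \<times> 'i \<times> 'l) set" where
  "rbar G \<Lambda> i = carrier G \<times> {i} \<times> \<Lambda>"

definition rho :: "('g, 'm) monoid_scheme \<Rightarrow> 'i set \<Rightarrow> 'l \<Rightarrow> 'l \<Rightarrow> 'g \<Rightarrow> ('g \<times> 'i \<times> 'l) map_arr" where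
  "rho G I l1 l2 g =
     (lbar G I l1, \<lambda>(h, i, l)\<in>lbar G I l1. (h \<otimes>\<^bsub>G\<^esub> g, i, l2), lbar G I l2)"

definition kappa :: "('g, 'm) monoid_scheme \<Rightarrow> 'l set \<Rightarrow> 'i \<Rightarrow> 'i \<Rightarrow> 'g \<Rightarrow> ('g \<times> 'i \<times> 'l) map_arr" where
  "kappa G \<Lambda> i1 i2 g =
     (rbar G \<Lambda> i1, \<lambda>(h, i, l)\<in>rbar G \<Lambda> i1. (g \<otimes>\<^bsub>G\<^esub> h, i2, l), rbar G \<Lambda> i2)"

definition left_cat :: "('g, 'm) monoid_scheme \<Rightarrow> 'i set \<Rightarrow> 'l set \<Rightarrow> ('l \<Rightarrow> 'i \<Rightarrow> 'g) \<Rightarrow>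
    (('g \<times> 'i \<times> 'l) set, ('g \<times> 'i \<times> 'l) map_arr) cat" where
  "left_cat G I \<Lambda> P = set_cat\<lparr>
     Obj := principal_left_ideals (rees G I \<Lambda> P),
     Arr := {rho G I l1 l2 g | l1 l2 g. l1 \<in> \<Lambda> \<and> l2 \<in> \<Lambda> \<and> g \<in> carrier G},
     Incl := Ident set_cat ` principal_left_ideals (rees G I \<Lambda> P)\<rparr>"

definition right_cat :: "('g, 'm) monoid_scheme \<Rightarrow> 'i set \<Rightarrow> 'l set \<Rightarrow> ('l \<Rightarrow> 'i \<Rightarrow> 'g) \<Rightarrow>
    (('g \<times> 'i \<times> 'l) set, ('g \<times> 'i \<times> 'l) map_arr) cat" where
  "right_cat G I \<Lambda> P = set_cat\<lparr>
     Obj := principal_right_ideals (rees G I \<Lambda> P),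
     Arr := {kappa G \<Lambda> i1 i2 g | i1 i2 g. i1 \<in> I \<and> i2 \<in> I \<and> g \<in> carrier G},
     Incl := Ident set_cat ` principal_right_ideals (rees G I \<Lambda> P)\<rparr>"

type_synonym ('g, 'i, 'l) left_cone =
  "(('g \<times> 'i \<times> 'l) set, ('g \<times> 'i \<times> 'l) map_arr) cone"

type_synonym ('g, 'i, 'l) left_set_func =
  "(('g \<times> 'i \<times> 'l) set, ('g \<times> 'i \<times> 'l) map_arr, ('g, 'i, 'l) left_cone) set_func"

text \<open>The cone identified with a pair \<open>(x, l)\<close>, where \<open>x \<in> G\<^sup>\<Lambda>\<close>: its component at \<open>lbar G I m\<close>
  is \<open>rho G I m l (x m)\<close>.\<close>

definition pair_cone :: "('g, 'm) monoid_scheme \<Rightarrow> 'i set \<Rightarrow> 'l set \<Rightarrow> ('l \<Rightarrow> 'i \<Rightarrow> 'g) \<Rightarrow>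
    ('l \<Rightarrow> 'g) \<Rightarrow> 'l \<Rightarrow> ('g, 'i, 'l) left_cone" where
  "pair_cone G I \<Lambda> P x l =
     (\<lambda>c\<in>Obj (left_cat G I \<Lambda> P). (let m = (THE m. c = lbar G I m) in rho G I m l (x m)),
      lbar G I l)"

abbreviation G_power :: "('g, 'm) monoid_scheme \<Rightarrow> 'l set \<Rightarrow> ('l \<Rightarrow> 'g) monoid" where
  "G_power G \<Lambda> \<equiv> product_group \<Lambda> (\<lambda>_. G)"

definition constants :: "('g, 'm) monoid_scheme \<Rightarrow> 'l set \<Rightarrow> ('l \<Rightarrow> 'g) set" where
  "constants G \<Lambda> = {\<lambda>l\<in>\<Lambda>. g | g. g \<in> carrier G}"

definition left_coset :: "('g, 'm) monoid_scheme \<Rightarrow> 'l set \<Rightarrow> ('l \<Rightarrow> 'g) \<Rightarrow> ('l \<Rightarrow> 'g) set" where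
  "left_coset G \<Lambda> x = x <#\<^bsub>G_power G \<Lambda>\<^esub> constants G \<Lambda>"

text \<open>The object \<open>H(\<gamma>; -)\<close> is identified with the left coset of \<open>x\<close>, for \<open>\<gamma>\<close> the cone of \<open>(x, k)\<close>.
  The following definition is the set-valued functor that a coset \<open>K\<close> stands for;
  the identification is justified by \<open>H_functor_pair_cone\<close> and \<open>coset_object_inj\<close> below.\<close>

definition coset_fibre :: "('g, 'm) monoid_scheme \<Rightarrow> 'i set \<Rightarrow> 'l set \<Rightarrow> ('l \<Rightarrow> 'i \<Rightarrow> 'g) \<Rightarrow>
    ('l \<Rightarrow> 'g) set \<Rightarrow> ('g \<times> 'i \<times> 'l) set \<Rightarrow> ('g, 'i, 'l) left_cone set" where
  "coset_fibre G I \<Lambda> P K c = {pair_cone G I \<Lambda> P y l | y l. y \<in> K \<and> l \<in> \<Lambda> \<and> c = lbar G I l}"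

definition coset_object :: "('g, 'm) monoid_scheme \<Rightarrow> 'i set \<Rightarrow> 'l set \<Rightarrow> ('l \<Rightarrow> 'i \<Rightarrow> 'g) \<Rightarrow>
    ('l \<Rightarrow> 'g) set \<Rightarrow> ('g, 'i, 'l) left_set_func" where
  "coset_object G I \<Lambda> P K = (let L = left_cat G I \<Lambda> P; E = coset_fibre G I \<Lambda> P K in \<lparr>
     on_obj = (\<lambda>c\<in>Obj L. E c),
     on_arr = (\<lambda>f\<in>Arr L. (E (Dom L f), \<lambda>\<delta>\<in>E (Dom L f). cone_act L \<delta> f, E (Cod L f)))\<rparr>)"

definition column :: "'l set \<Rightarrow> ('l \<Rightarrow> 'i \<Rightarrow> 'g) \<Rightarrow> 'i \<Rightarrow> ('l \<Rightarrow> 'g)" where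
  "column \<Lambda> A i = (\<lambda>l\<in>\<Lambda>. A l i)"

section \<open>Explicit descriptions and the identification with cosets\<close>

context
  fixes G :: "('g, 'm) monoid_scheme" (structure) and I :: "'i set" and \<Lambda> :: "'l set"
    and P :: "'l \<Rightarrow> 'i \<Rightarrow> 'g"
  assumes group_G: "group G" and I_ne: "I \<noteq> {}" and \<Lambda>_ne: "\<Lambda> \<noteq> {}"
    and P_mem: "\<And>l i. l \<in> \<Lambda> \<Longrightarrow> i \<in> I \<Longrightarrow> P l i \<in> carrier G"
begin

interpretation group G by (fact group_G)

lemma principal_left_ideals_rees: "principal_left_ideals (rees G I \<Lambda> P) = lbar G I ` \<Lambda>"
proof -
  have *: "insert (a, i, l) {smult (rees G I \<Lambda> P) s (a, i, l) | s. s \<in> scarrier (rees G I \<Lambda> P)}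
      = lbar G I l" (is "?L = _")
    if "a \<in> carrier G" "i \<in> I" "l \<in> \<Lambda>" for a i l
  proof
    show "?L \<subseteq> lbar G I l"
      using that P_mem by (auto simp: rees_def lbar_def)
    show "lbar G I l \<subseteq> ?L"
    proof
      fix z assume "z \<in> lbar G I l"
      then obtain b j where z: "z = (b, j, l)" "b \<in> carrier G" "j \<in> I"
        by (auto simp: lbar_def)
      define s where "s = (b \<otimes> inv (P l i \<otimes> a), j, l)"
      have "s \<in> scarrier (rees G I \<Lambda> P)" "z = smult (rees G I \<Lambda> P) s (a, i, l)"
        using that z P_mem[of l i] by (auto simp: s_def rees_def m_assoc inv_solve_right)
      then show "z \<in> ?L" by blast
    qed
  qed
  show ?thesis
  proof
    show "principal_left_ideals (rees G I \<Lambda> P) \<subseteq> lbar G I ` \<Lambda>"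
      unfolding principal_left_ideals_def using * by (auto simp: rees_def[of G I \<Lambda> P])
    show "lbar G I ` \<Lambda> \<subseteq> principal_left_ideals (rees G I \<Lambda> P)"
    proof
      fix X assume "X \<in> lbar G I ` \<Lambda>"
      then obtain l where l: "l \<in> \<Lambda>" "X = lbar G I l" by blast
      obtain i where i: "i \<in> I" using I_ne by blast
      have "(\<one>, i, l) \<in> scarrier (rees G I \<Lambda> P)" using i l by (simp add: rees_def)
      then show "X \<in> principal_left_ideals (rees G I \<Lambda> P)"
        unfolding principal_left_ideals_def using *[of \<one> i l] i l by blast
    qed
  qed
qed

lemma principal_right_ideals_rees: "principal_right_ideals (rees G I \<Lambda> P) = rbar G \<Lambda> ` I"
proof -
  have *: "insert (a, i, l) {smult (rees G I \<Lambda> P) (a, i, l) s | s. s \<in> scarrier (rees G I \<Lambda> P)}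
      = rbar G \<Lambda> i" (is "?L = _")
    if "a \<in> carrier G" "i \<in> I" "l \<in> \<Lambda>" for a i l
  proof
    show "?L \<subseteq> rbar G \<Lambda> i"
      using that P_mem by (auto simp: rees_def rbar_def)
    show "rbar G \<Lambda> i \<subseteq> ?L"
    proof
      fix z assume "z \<in> rbar G \<Lambda> i"
      then obtain b m where z: "z = (b, i, m)" "b \<in> carrier G" "m \<in> \<Lambda>"
        by (auto simp: rbar_def)
      define s where "s = (inv (a \<otimes> P l i) \<otimes> b, i, m)"
      have "s \<in> scarrier (rees G I \<Lambda> P)" "z = smult (rees G I \<Lambda> P) (a, i, l) s"
        using that z P_mem[of l i] by (auto simp: s_def rees_def m_assoc[symmetric])
      then show "z \<in> ?L" by blast
    qed
  qed
  show ?thesis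
  proof
    show "principal_right_ideals (rees G I \<Lambda> P) \<subseteq> rbar G \<Lambda> ` I"
      unfolding principal_right_ideals_def using * by (auto simp: rees_def[of G I \<Lambda> P])
    show "rbar G \<Lambda> ` I \<subseteq> principal_right_ideals (rees G I \<Lambda> P)"
    proof
      fix X assume "X \<in> rbar G \<Lambda> ` I"
      then obtain i where i: "i \<in> I" "X = rbar G \<Lambda> i" by blast
      obtain l where l: "l \<in> \<Lambda>" using \<Lambda>_ne by blast
      have "(\<one>, i, l) \<in> scarrier (rees G I \<Lambda> P)" using i l by (simp add: rees_def)
      then show "X \<in> principal_right_ideals (rees G I \<Lambda> P)"
        unfolding principal_right_ideals_def using *[of \<one> i l] i l by blast
    qed
  qed
qed

abbreviation (input) "lcat \<equiv> left_cat G I \<Lambda> P"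

lemma lbar_inject [simp]: "lbar G I l = lbar G I m \<longleftrightarrow> l = m"
proof
  assume eq: "lbar G I l = lbar G I m"
  obtain i where "i \<in> I" using I_ne by blast
  then have "(\<one>, i, l) \<in> lbar G I m" unfolding eq[symmetric] by (simp add: lbar_def)
  then show "l = m" by (simp add: lbar_def)
qed simp

lemma rho_inject:
  assumes "g \<in> carrier G" "h \<in> carrier G" "rho G I l m g = rho G I l m h"
  shows "g = h"
proof -
  obtain i where i: "i \<in> I" using I_ne by blast
  have "map_fun (rho G I l m g) (\<one>, i, l) = map_fun (rho G I l m h) (\<one>, i, l)"
    using assms(3) by simp
  then show ?thesis using i assms(1,2) by (simp add: rho_def map_fun_def lbar_def)
qed

lemma left_cat_simps [simp]:
  "Obj lcat = lbar G I ` \<Lambda>"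
  "Arr lcat = {rho G I l1 l2 g | l1 l2 g. l1 \<in> \<Lambda> \<and> l2 \<in> \<Lambda> \<and> g \<in> carrier G}"
  "Dom lcat (rho G I l m g) = lbar G I l"
  "Cod lcat (rho G I l m g) = lbar G I m"
  by (auto simp: left_cat_def principal_left_ideals_rees set_cat_def rho_def map_dom_def map_cod_def)

lemma Ident_left_cat: "Ident lcat (lbar G I l) = rho G I l l \<one>"
  by (auto simp: left_cat_def set_cat_def rho_def lbar_def restrict_def)

lemma Incl_left_cat: "Incl lcat = {rho G I l l \<one> | l. l \<in> \<Lambda>}"
proof -
  have "Incl lcat = Ident lcat ` lbar G I ` \<Lambda>"
    by (simp add: left_cat_def principal_left_ideals_rees)
  then show ?thesis by (auto simp: image_image Ident_left_cat simp del: left_cat_simps)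
qed

lemma Comp_left_cat:
  assumes "g \<in> carrier G" "h \<in> carrier G"
  shows "Comp lcat (rho G I l m g) (rho G I m n h) = rho G I l n (g \<otimes> h)"
  using assms
  by (auto simp: left_cat_def set_cat_def rho_def map_dom_def map_cod_def map_fun_def lbar_def
      compose_def m_assoc intro!: restrict_ext)

lemma hom_left_cat:
  assumes "l \<in> \<Lambda>" "m \<in> \<Lambda>"
  shows "hom_set lcat (lbar G I l) (lbar G I m) = {rho G I l m g | g. g \<in> carrier G}"
proof (intro Set.set_eqI iffI)
  fix f assume "f \<in> hom_set lcat (lbar G I l) (lbar G I m)"
  then show "f \<in> {rho G I l m g | g. g \<in> carrier G}"
    by (auto simp: hom_set_def)
next
  fix f assume "f \<in> {rho G I l m g | g. g \<in> carrier G}"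
  then show "f \<in> hom_set lcat (lbar G I l) (lbar G I m)"
    using assms by (auto simp: hom_set_def)
qed

lemma isomorphism_left_cat:
  assumes "l \<in> \<Lambda>" "m \<in> \<Lambda>" "g \<in> carrier G"
  shows "isomorphism lcat (rho G I l m g)"
proof -
  have "rho G I m l (inv g) \<in> hom_set lcat (lbar G I m) (lbar G I l)"
    using assms by (auto simp: hom_left_cat)
  moreover have "rho G I l m g \<in> Arr lcat" using assms by auto
  moreover have "Comp lcat (rho G I l m g) (rho G I m l (inv g)) = Ident lcat (lbar G I l)"
    "Comp lcat (rho G I m l (inv g)) (rho G I l m g) = Ident lcat (lbar G I m)"
    using assms by (simp_all add: Comp_left_cat Ident_left_cat)
  ultimately show ?thesis
    unfolding isomorphism_def left_cat_simps(3,4) by blast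
qed

lemma pair_cone_component [simp]:
  "m \<in> \<Lambda> \<Longrightarrow> fst (pair_cone G I \<Lambda> P x l) (lbar G I m) = rho G I m l (x m)"
  by (simp add: pair_cone_def)

lemma pair_cone_vertex [simp]: "snd (pair_cone G I \<Lambda> P x l) = lbar G I l"
  by (simp add: pair_cone_def)

lemma cone_eqI:
  assumes "fst \<gamma> \<in> extensional (Obj lcat)" "fst \<delta> \<in> extensional (Obj lcat)" "snd \<gamma> = snd \<delta>"
    "\<And>m. m \<in> \<Lambda> \<Longrightarrow> fst \<gamma> (lbar G I m) = fst \<delta> (lbar G I m)"
  shows "\<gamma> = (\<delta> :: ('g, 'i, 'l) left_cone)"
proof (rule prod_eqI)
  show "fst \<gamma> = fst \<delta>"
    by (rule extensionalityI[OF assms(1,2)]) (use assms(4) in auto)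
qed fact

lemma pair_cone_extensional: "fst (pair_cone G I \<Lambda> P x l) \<in> extensional (Obj lcat)"
  unfolding pair_cone_def fst_conv by (rule restrict_extensional)

text \<open>The pairs in \<open>G\<^sup>\<Lambda> \<times> \<Lambda>\<close> correspond bijectively to the normal cones, and the product
  of cones is the one given by the usual formula on pairs.\<close>

lemma pair_cone_inject:
  assumes "x \<in> \<Lambda> \<rightarrow>\<^sub>E carrier G" "y \<in> \<Lambda> \<rightarrow>\<^sub>E carrier G"
  shows "pair_cone G I \<Lambda> P x l = pair_cone G I \<Lambda> P y m \<longleftrightarrow> x = y \<and> l = m"
proof
  assume eq: "pair_cone G I \<Lambda> P x l = pair_cone G I \<Lambda> P y m"
  then have lm: "l = m" using pair_cone_vertex[of x l] pair_cone_vertex[of y m] by simp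
  have "x k = y k" if k: "k \<in> \<Lambda>" for k
  proof -
    have "rho G I k l (x k) = rho G I k l (y k)"
      using eq lm pair_cone_component[OF k, of x l] pair_cone_component[OF k, of y l] by simp
    then show ?thesis
      using rho_inject[of "x k" "y k"] PiE_mem[OF assms(1) k] PiE_mem[OF assms(2) k] by simp
  qed
  then show "x = y \<and> l = m" using lm PiE_ext[OF assms] by simp
qed simp

lemma normal_cones_left_cat:
  "normal_cones lcat = {pair_cone G I \<Lambda> P x l | x l. x \<in> \<Lambda> \<rightarrow>\<^sub>E carrier G \<and> l \<in> \<Lambda>}"
proof (intro Set.set_eqI iffI)
  fix \<gamma> assume \<gamma>: "\<gamma> \<in> normal_cones lcat"
  then have ext: "fst \<gamma> \<in> extensional (Obj lcat)" and v: "snd \<gamma> \<in> Obj lcat"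
    and hom: "\<And>c. c \<in> Obj lcat \<Longrightarrow> fst \<gamma> c \<in> hom_set lcat c (snd \<gamma>)"
    unfolding normal_cones_def by (simp_all only: mem_Collect_eq case_prod_beta)
  obtain l where l: "l \<in> \<Lambda>" "snd \<gamma> = lbar G I l"
    using v by auto
  have "\<forall>m\<in>\<Lambda>. \<exists>g. g \<in> carrier G \<and> fst \<gamma> (lbar G I m) = rho G I m l g"
  proof
    fix m assume m: "m \<in> \<Lambda>"
    then have "fst \<gamma> (lbar G I m) \<in> hom_set lcat (lbar G I m) (lbar G I l)"
      using hom[of "lbar G I m"] l by simp
    then show "\<exists>g. g \<in> carrier G \<and> fst \<gamma> (lbar G I m) = rho G I m l g"
      using hom_left_cat[OF m l(1)] by blast
  qed
  from bchoice[OF this] obtain x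
    where x: "\<forall>m\<in>\<Lambda>. x m \<in> carrier G \<and> fst \<gamma> (lbar G I m) = rho G I m l (x m)" by (elim exE)
  have "\<gamma> = pair_cone G I \<Lambda> P (restrict x \<Lambda>) l"
    by (rule cone_eqI[OF ext pair_cone_extensional]) (use l x in simp_all)
  then show "\<gamma> \<in> {pair_cone G I \<Lambda> P x l | x l. x \<in> \<Lambda> \<rightarrow>\<^sub>E carrier G \<and> l \<in> \<Lambda>}"
    using x l by (intro CollectI exI[of _ "restrict x \<Lambda>"] exI[of _ l]) auto
next
  fix \<gamma> assume "\<gamma> \<in> {pair_cone G I \<Lambda> P x l | x l. x \<in> \<Lambda> \<rightarrow>\<^sub>E carrier G \<and> l \<in> \<Lambda>}"
  then obtain x l where x: "\<gamma> = pair_cone G I \<Lambda> P x l" "x \<in> \<Lambda> \<rightarrow>\<^sub>E carrier G" "l \<in> \<Lambda>" by blast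
  have xm: "x m \<in> carrier G" if "m \<in> \<Lambda>" for m using x that by auto
  have "\<exists>c\<in>Obj lcat. isomorphism lcat (fst \<gamma> c)"
  proof -
    obtain m where "m \<in> \<Lambda>" using \<Lambda>_ne by blast
    then show ?thesis using x xm by (intro bexI[of _ "lbar G I m"]) (simp_all add: isomorphism_left_cat)
  qed
  moreover have "\<forall>c\<in>Obj lcat. fst \<gamma> c \<in> hom_set lcat c (snd \<gamma>)"
  proof
    fix c assume "c \<in> Obj lcat"
    then obtain m where m: "m \<in> \<Lambda>" "c = lbar G I m" by auto
    then show "fst \<gamma> c \<in> hom_set lcat c (snd \<gamma>)"
      unfolding x(1) pair_cone_vertex m(2) pair_cone_component[OF m(1)] hom_left_cat[OF m(1) x(3)]
      using xm[OF m(1)] by blast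
  qed
  moreover have "\<forall>j\<in>Incl lcat. Comp lcat j (fst \<gamma> (Cod lcat j)) = fst \<gamma> (Dom lcat j)"
  proof
    fix j assume "j \<in> Incl lcat"
    then obtain m where m: "m \<in> \<Lambda>" "j = rho G I m m \<one>" unfolding Incl_left_cat by blast
    then show "Comp lcat j (fst \<gamma> (Cod lcat j)) = fst \<gamma> (Dom lcat j)"
      using x xm by (simp add: Comp_left_cat)
  qed
  moreover have "fst \<gamma> \<in> extensional (Obj lcat)" unfolding x(1) by (rule pair_cone_extensional)
  moreover have "snd \<gamma> \<in> Obj lcat" using x by simp
  ultimately show "\<gamma> \<in> normal_cones lcat"
    unfolding normal_cones_def by (simp only: mem_Collect_eq case_prod_beta)
qed

lemma cone_act_pair_cone:
  assumes "x \<in> \<Lambda> \<rightarrow>\<^sub>E carrier G" "g \<in> carrier G"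
  shows "cone_act lcat (pair_cone G I \<Lambda> P x k) (rho G I k l g) =
    pair_cone G I \<Lambda> P (x \<otimes>\<^bsub>G_power G \<Lambda>\<^esub> (\<lambda>_\<in>\<Lambda>. g)) l"
proof (rule cone_eqI)
  show "fst (cone_act lcat (pair_cone G I \<Lambda> P x k) (rho G I k l g)) \<in> extensional (Obj lcat)"
    by (simp add: cone_act_def del: left_cat_simps(1))
  fix m assume m: "m \<in> \<Lambda>"
  then have "x m \<in> carrier G" using assms by auto
  then show "fst (cone_act lcat (pair_cone G I \<Lambda> P x k) (rho G I k l g)) (lbar G I m)
      = fst (pair_cone G I \<Lambda> P (x \<otimes>\<^bsub>G_power G \<Lambda>\<^esub> (\<lambda>_\<in>\<Lambda>. g)) l) (lbar G I m)"
    using m assms by (simp add: cone_act_def Comp_left_cat product_group_def)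
qed (simp_all only: pair_cone_extensional, simp add: cone_act_def)

lemma cone_mult_pair_cone:
  assumes "x \<in> \<Lambda> \<rightarrow>\<^sub>E carrier G" "y \<in> \<Lambda> \<rightarrow>\<^sub>E carrier G" "k \<in> \<Lambda>"
  shows "cone_mult lcat (pair_cone G I \<Lambda> P x k) (pair_cone G I \<Lambda> P y l) =
    pair_cone G I \<Lambda> P (x \<otimes>\<^bsub>G_power G \<Lambda>\<^esub> (\<lambda>_\<in>\<Lambda>. y k)) l"
proof -
  have "y k \<in> carrier G" using assms by auto
  then show ?thesis using assms by (simp add: cone_mult_def cone_act_pair_cone)
qed

lemma H_obj_pair_cone:
  assumes "x \<in> \<Lambda> \<rightarrow>\<^sub>E carrier G" "k \<in> \<Lambda>" "l \<in> \<Lambda>"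
  shows "H_obj lcat (pair_cone G I \<Lambda> P x k) (lbar G I l) =
    {pair_cone G I \<Lambda> P (x \<otimes>\<^bsub>G_power G \<Lambda>\<^esub> (\<lambda>_\<in>\<Lambda>. g)) l | g. g \<in> carrier G}"
proof -
  have "H_obj lcat (pair_cone G I \<Lambda> P x k) (lbar G I l) =
      {cone_act lcat (pair_cone G I \<Lambda> P x k) (rho G I k l g) | g. g \<in> carrier G}"
    unfolding H_obj_def pair_cone_vertex hom_left_cat[OF assms(2,3)] by blast
  also have "\<dots> = {pair_cone G I \<Lambda> P (x \<otimes>\<^bsub>G_power G \<Lambda>\<^esub> (\<lambda>_\<in>\<Lambda>. g)) l | g. g \<in> carrier G}"
    using cone_act_pair_cone[OF assms(1)] by (intro Collect_cong iff_exI) (metis (full_types))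
  finally show ?thesis .
qed

lemma coset_fibre_left_coset:
  assumes "l \<in> \<Lambda>"
  shows "coset_fibre G I \<Lambda> P (left_coset G \<Lambda> x) (lbar G I l) =
    {pair_cone G I \<Lambda> P (x \<otimes>\<^bsub>G_power G \<Lambda>\<^esub> (\<lambda>_\<in>\<Lambda>. g)) l | g. g \<in> carrier G}"
proof -
  have "left_coset G \<Lambda> x = {x \<otimes>\<^bsub>G_power G \<Lambda>\<^esub> (\<lambda>_\<in>\<Lambda>. g) | g. g \<in> carrier G}"
    unfolding left_coset_def l_coset_def constants_def by blast
  then show ?thesis using assms by (simp only: coset_fibre_def lbar_inject) blast
qed

lemma H_functor_pair_cone:
  assumes "x \<in> \<Lambda> \<rightarrow>\<^sub>E carrier G" "k \<in> \<Lambda>"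
  shows "H_functor lcat (pair_cone G I \<Lambda> P x k) = coset_object G I \<Lambda> P (left_coset G \<Lambda> x)"
proof -
  have fib: "H_obj lcat (pair_cone G I \<Lambda> P x k) c = coset_fibre G I \<Lambda> P (left_coset G \<Lambda> x) c"
    if "c \<in> Obj lcat" for c
    using that assms by (auto simp: H_obj_pair_cone coset_fibre_left_coset)
  show ?thesis
    unfolding H_functor_def coset_object_def Let_def using fib by (auto intro!: restrict_ext)
qed

lemma H_functor_arr:
  assumes "\<gamma> \<in> normal_cones lcat" "f \<in> hom_set lcat (snd \<gamma>) c" "f' \<in> hom_set lcat c c'"
  shows "map_fun (on_arr (H_functor lcat \<gamma>) f') (cone_act lcat \<gamma> f) = cone_act lcat \<gamma> (Comp lcat f f')"
proof -
  obtain x k where x: "\<gamma> = pair_cone G I \<Lambda> P x k" "x \<in> \<Lambda> \<rightarrow>\<^sub>E carrier G" "k \<in> \<Lambda>"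
    using assms(1) by (auto simp: normal_cones_left_cat)
  obtain l l' where l: "l \<in> \<Lambda>" "c = lbar G I l" "l' \<in> \<Lambda>" "c' = lbar G I l'"
    using assms(2,3) by (auto simp: hom_set_def)
  obtain g where g: "g \<in> carrier G" "f = rho G I k l g"
    using assms(2) x l by (auto simp: hom_left_cat)
  obtain g' where g': "g' \<in> carrier G" "f' = rho G I l l' g'"
    using assms(3) l by (auto simp: hom_left_cat)
  have mem: "cone_act lcat \<gamma> f \<in> H_obj lcat \<gamma> (Dom lcat f')"
  proof -
    have "Dom lcat f' = c" using assms(3) by (simp add: hom_set_def)
    then show ?thesis using assms(2) unfolding H_obj_def by blast
  qed
  have arr: "f' \<in> Arr lcat" using assms(3) by (simp add: hom_set_def)
  have "map_fun (on_arr (H_functor lcat \<gamma>) f') (cone_act lcat \<gamma> f) = cone_act lcat (cone_act lcat \<gamma> f) f'"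
    using mem arr by (simp add: H_functor_def map_fun_def del: left_cat_simps)
  also have "\<dots> = cone_act lcat \<gamma> (Comp lcat f f')"
  proof -
    have xg: "x \<otimes>\<^bsub>G_power G \<Lambda>\<^esub> (\<lambda>_\<in>\<Lambda>. g) \<in> \<Lambda> \<rightarrow>\<^sub>E carrier G"
      using x g by (auto simp: product_group_def)
    have "x m \<in> carrier G" if "m \<in> \<Lambda>" for m using x that by auto
    then have "(x \<otimes>\<^bsub>G_power G \<Lambda>\<^esub> (\<lambda>_\<in>\<Lambda>. g)) \<otimes>\<^bsub>G_power G \<Lambda>\<^esub> (\<lambda>_\<in>\<Lambda>. g') =
        x \<otimes>\<^bsub>G_power G \<Lambda>\<^esub> (\<lambda>_\<in>\<Lambda>. g \<otimes> g')"
      using g g' by (auto simp: product_group_def m_assoc intro!: restrict_ext)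
    then show ?thesis
      using x xg g g' by (simp add: Comp_left_cat cone_act_pair_cone)
  qed
  finally show ?thesis .
qed

lemma left_coset_subset:
  assumes "x \<in> \<Lambda> \<rightarrow>\<^sub>E carrier G"
  shows "left_coset G \<Lambda> x \<subseteq> \<Lambda> \<rightarrow>\<^sub>E carrier G"
proof -
  have "x m \<in> carrier G" if "m \<in> \<Lambda>" for m using assms that by auto
  then show ?thesis by (auto simp: left_coset_def l_coset_def constants_def product_group_def)
qed

lemma coset_object_inj:
  assumes "K \<subseteq> \<Lambda> \<rightarrow>\<^sub>E carrier G" "K' \<subseteq> \<Lambda> \<rightarrow>\<^sub>E carrier G"
    and "coset_object G I \<Lambda> P K = coset_object G I \<Lambda> P K'"
  shows "K = K'"
proof -
  obtain l where l: "l \<in> \<Lambda>" using \<Lambda>_ne by blast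
  have "on_obj (coset_object G I \<Lambda> P K) (lbar G I l) = on_obj (coset_object G I \<Lambda> P K') (lbar G I l)"
    using assms(3) by simp
  then have eq: "{pair_cone G I \<Lambda> P y l | y. y \<in> K} = {pair_cone G I \<Lambda> P y l | y. y \<in> K'}"
    using l by (simp add: coset_object_def Let_def coset_fibre_def)
  have sub: "A \<subseteq> B"
    if A: "A \<subseteq> \<Lambda> \<rightarrow>\<^sub>E carrier G" and B: "B \<subseteq> \<Lambda> \<rightarrow>\<^sub>E carrier G"
      and AB: "{pair_cone G I \<Lambda> P y l | y. y \<in> A} = {pair_cone G I \<Lambda> P y l | y. y \<in> B}"
    for A B :: "('l \<Rightarrow> 'g) set"
  proof
    fix y assume y: "y \<in> A"
    then have "pair_cone G I \<Lambda> P y l \<in> {pair_cone G I \<Lambda> P y l | y. y \<in> B}"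
      using AB by blast
    then obtain z where z: "z \<in> B" "pair_cone G I \<Lambda> P y l = pair_cone G I \<Lambda> P z l"
      by blast
    have "y = z" using pair_cone_inject[of y z l l] y z A B by blast
    then show "y \<in> B" using z by simp
  qed
  show ?thesis using sub[of K K'] sub[of K' K] assms eq by simp
qed

end

end

theory Submission
  imports Defs
begin

text \<open>A cross-connection is in particular a functor, so it sends each
  \<open>rbar G \<Lambda> i\<close> to an object of the normal dual, that is, to
  \<open>H_functor\<close> of some idempotent cone. Normal cones are pairs \<open>(x, k)\<close>
  (\<open>normal_cones_left_cat\<close>), and acting on such a cone by \<open>rho\<close> multiplies
  \<open>x\<close> on the right by a constant, so the functor is the one that the coset of
  \<open>x\<close> stands for (\<open>H_functor_pair_cone\<close>). A representative
  \<open>x\<close> chosen for each \<open>i\<close> serves as the \<open>i\<close>-th column of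
  \<open>A\<close>.\<close>

lemma normal_dual_left_cat_coset:
  assumes "group G" "I \<noteq> {}" "\<Lambda> \<noteq> {}"
    and P: "\<And>l i. l \<in> \<Lambda> \<Longrightarrow> i \<in> I \<Longrightarrow> P l i \<in> carrier G"
    and F: "F \<in> Obj (normal_dual (left_cat G I \<Lambda> P))"
  shows "\<exists>x. x \<in> \<Lambda> \<rightarrow>\<^sub>E carrier G \<and> F = coset_object G I \<Lambda> P (left_coset G \<Lambda> x)"
proof -
  obtain \<epsilon> where \<epsilon>: "\<epsilon> \<in> normal_cones (left_cat G I \<Lambda> P)" "F = H_functor (left_cat G I \<Lambda> P) \<epsilon>"
    using F by (auto simp: normal_dual_def full_subcat_def idempotent_cones_def)
  then obtain x k where x: "\<epsilon> = pair_cone G I \<Lambda> P x k" "x \<in> \<Lambda> \<rightarrow>\<^sub>E carrier G" "k \<in> \<Lambda>"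
    using normal_cones_left_cat[OF assms(1-3) P] by auto
  \<comment> \<open>The vertex \<open>k\<close> drops out here: morphisms lead from it to every
    \<open>lbar G I l\<close>, so only the coset of \<open>x\<close> survives in the
    functor.\<close>
  then show ?thesis
    using \<epsilon>(2) H_functor_pair_cone[OF assms(1-3) P x(2,3)] by auto
qed

theorem theorem26:
  fixes G :: "('g, 'm) monoid_scheme"
    and I :: "'i set"
    and \<Lambda> :: "'l set"
    and P :: "'l \<Rightarrow> 'i \<Rightarrow> 'g"
  assumes "group G"
    and "I \<noteq> {}"
    and "\<Lambda> \<noteq> {}"
    and "\<And>l i. l \<in> \<Lambda> \<Longrightarrow> i \<in> I \<Longrightarrow> P l i \<in> carrier G"
    and "cross_connection \<Gamma> (right_cat G I \<Lambda> P) (left_cat G I \<Lambda> P)"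
  shows "\<exists>A :: 'l \<Rightarrow> 'i \<Rightarrow> 'g.
    (\<forall>l \<in> \<Lambda>. \<forall>i \<in> I. A l i \<in> carrier G) \<and>
    (\<forall>i \<in> I. on_obj \<Gamma> (rbar G \<Lambda> i) = coset_object G I \<Lambda> P (left_coset G \<Lambda> (column \<Lambda> A i)))"
proof -
  have "\<forall>i\<in>I. \<exists>x. x \<in> \<Lambda> \<rightarrow>\<^sub>E carrier G \<and>
      on_obj \<Gamma> (rbar G \<Lambda> i) = coset_object G I \<Lambda> P (left_coset G \<Lambda> x)"
  proof
    fix i assume "i \<in> I"
    then have "rbar G \<Lambda> i \<in> Obj (right_cat G I \<Lambda> P)"
      using principal_right_ideals_rees[OF assms(1-4)] by (simp add: right_cat_def)
    then have "on_obj \<Gamma> (rbar G \<Lambda> i) \<in> Obj (normal_dual (left_cat G I \<Lambda> P))"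
      using assms(5) by (simp add: cross_connection_def local_isomorphism_def is_functor_def)
    then show "\<exists>x. x \<in> \<Lambda> \<rightarrow>\<^sub>E carrier G \<and>
        on_obj \<Gamma> (rbar G \<Lambda> i) = coset_object G I \<Lambda> P (left_coset G \<Lambda> x)"
      by (intro normal_dual_left_cat_coset assms(1-4))
  qed
  \<comment> \<open>Representatives are chosen independently for each \<open>i\<close>; each is
    determined only up to right multiplication by a constant.\<close>
  from bchoice[OF this] obtain x where x: "\<And>i. i \<in> I \<Longrightarrow> x i \<in> \<Lambda> \<rightarrow>\<^sub>E carrier G"
    "\<And>i. i \<in> I \<Longrightarrow> on_obj \<Gamma> (rbar G \<Lambda> i) = coset_object G I \<Lambda> P (left_coset G \<Lambda> (x i))"
    by blast
  \<comment> \<open>\<open>column\<close> restricts to \<open>\<Lambda>\<close>; since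
    \<open>x i\<close> is extensional, this gives back exactly \<open>x i\<close>.\<close>
  have "column \<Lambda> (\<lambda>l i. x i l) i = x i" if "i \<in> I" for i
    unfolding column_def using x(1)[OF that] by (rule PiE_restrict)
  then show ?thesis
    using x by (intro exI[of _ "\<lambda>l i. x i l"]) auto
qed

end
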